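(* Let $p$ be a prime and let $n,k,n'\ge 1$ be integers with $k\le n$. Let $\mathcal{Q}_{\mathrm{in}}=(\mathcal{G}_{\mathrm{in}},\mathcal{C}_{\mathrm{in}})$ be a graph code on $n$ qupits encoding $k$ qupits: $\mathcal{G}_{\mathrm{in}}$ is an $\mathbb{F}_p$-labeled graph on $n$ vertices and $\mathcal{C}_{\mathrm{in}}\subseteq\mathbb{F}_p^n$ is a $k$-dimensional linear code with generator matrix $C_{\mathrm{in}}\in\mathbb{F}_p^{k\times n}$. Let $\mathcal{Q}_{\mathrm{out}}=(\mathcal{G}_{\mathrm{out}},\mathcal{C}_{\mathrm{out}})$ be a CWS code of length $n'$ over $p^k$-level systems, where the classical code $\mathcal{C}_{\mathrm{out}}\subseteq(\mathbb{F}_p^k)^{n'}$ is a nonempty set that need not be linear. Then the concatenated quantum code $\mathcal{Q}_c$ with inner code $\mathcal{Q}_{\mathrm{in}}$ and outer code $\mathcal{Q}_{\mathrm{out}}$ is the CWS code $(\mathcal{G}_c,\mathcal{C}_c)$ on $nn'$ qupits, where (i) $\mathcal{C}_c$ is the classical concatenated code with inner code $\mathcal{C}_{\mathrm{in}}$ and outer code $\mathcal{C}_{\mathrm{out}}$, i.e. $\mathcal{C}_c=\{(\mathbf{c}_1C_{\mathrm{in}},\dots,\mathbf{c}_{n'}C_{\mathrm{in}}) : (\mathbf{c}_1,\dots,\mathbf{c}_{n'})\in\mathcal{C}_{\mathrm{out}}\}$ with each $\mathbf{c}_m\in\mathbb{F}_p^k$ a row vector; and (ii) $\mathcal{G}_c$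 is the graph on the $nn'$ output vertices obtained from the encoding graph $\mathcal{G}_{\mathcal{Q}_c}^{\{enc\}}$ by the graph concatenation procedure (via generalized local complementations, performed in any order of the auxiliary vertices).
   Context: Qupits and graph states. $p$ is a prime, $\omega=e^{2\pi i/p}$. A qupit has orthonormal basis $\{|r\rangle: r\in\mathbb{F}_p\}$, $X|r\rangle=|r+1\rangle$, $Z|r\rangle=\omega^r|r\rangle$; for $\mathbf{a},\mathbf{b}\in\mathbb{F}_p^N$, $X^{\mathbf a}=X^{a_1}\otimes\cdots\otimes X^{a_N}$ and $Z^{\mathbf b}=Z^{b_1}\otimes\cdots\otimes Z^{b_N}$. A graph $\mathcal{G}$ on $N$ vertices (edges labeled by nonzero elements of $\mathbb{F}_p$, label $0$ meaning no edge) is identified with its adjacency matrix $G$, a symmetric $N\times N$ matrix over $\mathbb{F}_p$ with zero diagonal. Its graph state $|\psi\rangle_{\mathcal G}$ is the unique (up to scalar) unit vector fixed by all $X^{\mathbf{e}_i}Z^{\mathbf{g}_i}$, $1\le i\le N$, where $\mathbf{e}_i$ is the $i$-th standard basis vector and $\mathbf{g}_i$ the $i$-th row of $G$. CWS and graph codes. For a set $\mathcal{C}\subseteq\mathbb{F}_p^N$, the CWS code $(\mathcal{G},\mathcal{C})$ is the subspace spanned by $\{Z^{\mathbf c}|\psi\rangle_{\mathcal G}:\mathbf{c}\in\mathcal{C}\}$. If $\mathcal{C}$ is a linear subspace it is called a graph code. Outer code over $p^k$-level systems. Each $p^k$-level system is identified with a block of $k$ qupits. Thus the outer graph $\mathcal{G}_{\mathrm{out}}$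 is an $\mathbb{F}_p$-labeled graph on the $kn'$ vertices $(m,a)$, $1\le m\le n'$, $1\le a\le k$, with no edge between two vertices of the same block $m$ (a graph without loops on the $n'$ systems), $\mathcal{C}_{\mathrm{out}}\subseteq(\mathbb{F}_p^{k})^{n'}=\mathbb{F}_p^{kn'}$, and $\mathcal{Q}_{\mathrm{out}}=(\mathcal{G}_{\mathrm{out}},\mathcal{C}_{\mathrm{out}})$ is the corresponding CWS code in $(\mathbb{C}^{p})^{\otimes kn'}$. Inner encoder and concatenated code. The encoding circuit of the inner graph code applies $H^\dagger$ to each input qupit $q_a$ (where $H^\dagger|r\rangle=p^{-1/2}\sum_s\omega^{-rs}|s\rangle$), then the gate $C_z^{\alpha_{aj}}$ between $q_a$ and the $j$-th qupit of $|\psi\rangle_{\mathcal{G}_{\mathrm{in}}}$ (where $C_z|r\rangle|s\rangle=\omega^{rs}|r\rangle|s\rangle$ and $\alpha_{aj}$ are the entries of $C_{\mathrm{in}}$), then $H$ to each $q_a$, then measures all $q_a$ with outcome $0$ assumed. Up to normalization this is the isometry $E:(\mathbb{C}^p)^{\otimes k}\to(\mathbb{C}^p)^{\otimes n}$, $$E|\mathbf{x}\rangle=p^{-k/2}\sum_{\mathbf{r}\in\mathbb{F}_p^k}\omega^{-\mathbf{x}\cdot\mathbf{r}}\,Z^{\mathbf{r}C_{\mathrm{in}}}|\psi\rangle_{\mathcal{G}_{\mathrm{in}}},\qquad \mathbf{x}\in\mathbb{F}_p^k,$$ whose image is $\mathcal{Q}_{\mathrm{in}}$. The concatenated code $\mathcal{Q}_c$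 is the image of $\mathcal{Q}_{\mathrm{out}}$ under $E^{\otimes n'}$, where the $m$-th copy of $E$ acts on the $m$-th block of $k$ qupits. Encoding graph. $\mathcal{G}_{\mathcal{Q}_c}^{\{enc\}}$ has $kn'$ auxiliary vertices $(m,a)$ and $nn'$ output vertices (the $n'$ copies, $m=1,\dots,n'$, of the vertex set of $\mathcal{G}_{\mathrm{in}}$, ordered copy by copy). The auxiliary vertices induce $\mathcal{G}_{\mathrm{out}}$; each copy of the output vertices induces $\mathcal{G}_{\mathrm{in}}$; auxiliary vertex $(m,a)$ is joined to the $j$-th vertex of the $m$-th copy by an edge labeled $\alpha_{aj}$; there are no other edges. Generalized local complementation. For a graph with adjacency matrix $F=(f_{ij})$, a vertex $i$, the $i$-th row $\mathbf{f}_i$ of $F$, and a row vector $\mathbf{v}$ indexed by the vertices with $v_j=0$ whenever $j=i$ or $f_{ij}\ne0$, the generalized local complementation at $(i,\mathbf{v})$ replaces $F$ by $F+\mathbf{v}^T\mathbf{f}_i+\mathbf{f}_i^T\mathbf{v}$. Graph concatenation procedure. (1) For each auxiliary vertex $i$ let $\mathbf{v}^{(i)}$ be the vector whose entry at each output vertex is the label of the edge joining it to $i$ in the encoding graph, and whose other entries are $0$. (2) Delete all edges between auxiliary vertices and output vertices. (3) For the auxiliary vertices $i$, one after the other, perform the generalized local complementation at $(i,\mathbf{v}^{(i)})$ on the current graph. (4) Remove all auxiliary vertices. *)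

theory Defs
  imports "HOL-Analysis.Analysis" "Berlekamp_Zassenhaus.Finite_Field"
begin

text \<open>
  The field with \<open>p\<close> elements is \<open>'p mod_ring\<close> with \<open>'p :: prime_card\<close>, so that \<open>p = CARD('p)\<close>.
  Systems (vertices) are indexed by finite types. The basis of the space of qupits indexed by
  \<open>'v\<close> is \<open>'p mod_ring ^ 'v\<close>; hence a state is a vector in \<open>complex ^ ('p mod_ring ^ 'v)\<close> and an
  operator a matrix \<open>A\<close>, where the entry \<open>A $ s $ r\<close> is the coefficient of \<open>|s>\<close> in \<open>A |r>\<close>.
  Complex scaling and complex span are \<open>(*s)\<close> and \<open>vec.span\<close>.
\<close>

type_synonym ('p, 'v) fvec = "'p mod_ring ^ 'v"
type_synonym ('p, 'v) state = "complex ^ ('p mod_ring ^ 'v)"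
type_synonym ('p, 'v, 'w) operator = "complex ^ ('p mod_ring ^ 'v) ^ ('p mod_ring ^ 'w)"


subsection \<open>Pauli operators\<close>

definition residue :: "'p::prime_card mod_ring \<Rightarrow> nat" where
  "residue r = nat (to_int_mod_ring r)"

text \<open>\<open>omega_pow r\<close> is $\omega^r$ with $\omega = e^{2\pi i/p}$.\<close>

definition omega_pow :: "'p::prime_card mod_ring \<Rightarrow> complex" where
  "omega_pow r = exp (2 * of_real pi * \<i> / of_nat CARD('p)) ^ residue r"

definition X_qupit :: "complex ^ 'p::prime_card mod_ring ^ 'p mod_ring" where
  "X_qupit = (\<chi> s r. if s = r + 1 then 1 else 0)"

definition Z_qupit :: "complex ^ 'p::prime_card mod_ring ^ 'p mod_ring" where
  "Z_qupit = (\<chi> s r. if s = r then omega_pow r else 0)"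

text \<open>The operation \<open>(^)\<close> on \<open>vec\<close> is componentwise, so powers of matrices are iterated here.\<close>

definition matrix_pow :: "complex ^ 'd ^ 'd \<Rightarrow> nat \<Rightarrow> complex ^ 'd ^ ('d::finite)" where
  "matrix_pow A e = (((**) A) ^^ e) (mat 1)"

definition tensor_operators ::
  "('v \<Rightarrow> complex ^ 'p::prime_card mod_ring ^ 'p mod_ring) \<Rightarrow> ('p, 'v::finite, 'v) operator" where
  "tensor_operators A = (\<chi> s r. \<Prod>i\<in>UNIV. A i $ (s $ i) $ (r $ i))"

definition pauli_X :: "('p::prime_card, 'v::finite) fvec \<Rightarrow> ('p, 'v, 'v) operator" where
  "pauli_X a = tensor_operators (\<lambda>i. matrix_pow X_qupit (residue (a $ i)))"

definition pauli_Z :: "('p::prime_card, 'v::finite) fvec \<Rightarrow> ('p, 'v, 'v) operator" where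
  "pauli_Z b = tensor_operators (\<lambda>i. matrix_pow Z_qupit (residue (b $ i)))"


subsection \<open>Graph states and CWS codes\<close>

text \<open>A labeled graph is identified with its adjacency matrix; the label \<open>0\<close> means no edge.\<close>

definition labeled_graph :: "'p::prime_card mod_ring ^ 'v ^ 'v \<Rightarrow> bool" where
  "labeled_graph G \<longleftrightarrow> transpose G = G \<and> (\<forall>i. G $ i $ i = 0)"

definition is_graph_state ::
  "'p::prime_card mod_ring ^ 'v ^ 'v \<Rightarrow> ('p, 'v::finite) state \<Rightarrow> bool" where
  "is_graph_state G \<psi> \<longleftrightarrow>
     norm \<psi> = 1 \<and> (\<forall>i. (pauli_X (axis i 1) ** pauli_Z (row i G)) *v \<psi> = \<psi>)"

text \<open>
  The graph state of a labeled graph is only determined up to a phase. The choice of the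
  representative does not affect the codes defined from it, since these are subspaces.
\<close>

definition graph_state ::
  "'p::prime_card mod_ring ^ 'v ^ 'v \<Rightarrow> ('p, 'v::finite) state" where
  "graph_state G = (SOME \<psi>. is_graph_state G \<psi>)"

definition CWS_code ::
  "'p::prime_card mod_ring ^ 'v ^ 'v \<Rightarrow> ('p, 'v) fvec set \<Rightarrow> ('p, 'v::finite) state set" where
  "CWS_code G C = vec.span {pauli_Z c *v graph_state G | c. c \<in> C}"


subsection \<open>Classical codes\<close>

definition generator_matrix ::
  "'p::prime_card mod_ring ^ 'n ^ 'k \<Rightarrow> ('p, 'n::finite) fvec set \<Rightarrow> bool" where
  "generator_matrix A C \<longleftrightarrow>
     inj (\<lambda>a. row a A) \<and> vec.independent (rows A) \<and> vec.span (rows A) = C"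

text \<open>The identification of a family of blocks with a single vector.\<close>

definition join_blocks :: "'a ^ 'k ^ 'm \<Rightarrow> 'a ^ ('m::finite \<times> 'k::finite)" where
  "join_blocks c = (\<chi> u. c $ fst u $ snd u)"

definition block :: "'a ^ ('m::finite \<times> 'k::finite) \<Rightarrow> 'm \<Rightarrow> 'a ^ 'k" where
  "block x m = (\<chi> a. x $ (m, a))"

definition classical_concatenation ::
  "'p::prime_card mod_ring ^ 'n ^ 'k \<Rightarrow> ('p mod_ring ^ 'k ^ 'm) set \<Rightarrow>
   ('p, 'm::finite \<times> 'n::finite) fvec set" where
  "classical_concatenation A C = {join_blocks (\<chi> m. (c $ m) v* A) | c. c \<in> C}"


subsection \<open>Concatenated quantum code\<close>

text \<open>The state $E|x\rangle$.\<close>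

definition encoded_basis_state ::
  "'p::prime_card mod_ring ^ 'n ^ 'n \<Rightarrow> 'p mod_ring ^ 'n ^ 'k \<Rightarrow> ('p, 'k::finite) fvec \<Rightarrow>
   ('p, 'n::finite) state" where
  "encoded_basis_state G A x =
     of_real (real CARD('p) powr (- real CARD('k) / 2)) *s
     (\<Sum>r\<in>UNIV. omega_pow (- (\<Sum>a\<in>UNIV. x $ a * r $ a)) *s (pauli_Z (r v* A) *v graph_state G))"

definition inner_encoder ::
  "'p::prime_card mod_ring ^ 'n ^ 'n \<Rightarrow> 'p mod_ring ^ 'n ^ 'k \<Rightarrow>
   ('p, 'k::finite, 'n::finite) operator" where
  "inner_encoder G A = (\<chi> z x. encoded_basis_state G A x $ z)"

text \<open>The tensor product of one copy of \<open>E\<close> for each \<open>m :: 'm\<close>, the copy \<open>m\<close> acting on block \<open>m\<close>.\<close>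

definition tensor_power ::
  "('p::prime_card, 'k::finite, 'n::finite) operator \<Rightarrow> ('p, 'm::finite \<times> 'k, 'm \<times> 'n) operator"
where
  "tensor_power E = (\<chi> z x. \<Prod>m\<in>UNIV. E $ block z m $ block x m)"

definition concatenated_code ::
  "'p::prime_card mod_ring ^ 'n ^ 'n \<Rightarrow> 'p mod_ring ^ 'n ^ 'k \<Rightarrow>
   ('p, 'm::finite \<times> 'k::finite) state set \<Rightarrow> ('p, 'm \<times> 'n::finite) state set" where
  "concatenated_code G_in C_in Q_out = (\<lambda>\<phi>. tensor_power (inner_encoder G_in C_in) *v \<phi>) ` Q_out"


subsection \<open>Encoding graph and graph concatenation\<close>

text \<open>Auxiliary vertices are \<open>Inl (m, a)\<close>, output vertices are \<open>Inr (m, j)\<close>.\<close>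

definition encoding_graph ::
  "'p::prime_card mod_ring ^ ('m::finite \<times> 'k::finite) ^ ('m \<times> 'k) \<Rightarrow>
   'p mod_ring ^ 'n::finite ^ 'n \<Rightarrow> 'p mod_ring ^ 'n ^ 'k \<Rightarrow>
   'p mod_ring ^ ('m \<times> 'k + 'm \<times> 'n) ^ ('m \<times> 'k + 'm \<times> 'n)" where
  "encoding_graph G_out G_in A = (\<chi> u w.
     case (u, w) of
       (Inl i, Inl i') \<Rightarrow> G_out $ i $ i'
     | (Inl (m, a), Inr (m', j)) \<Rightarrow> (if m = m' then A $ a $ j else 0)
     | (Inr (m', j), Inl (m, a)) \<Rightarrow> (if m = m' then A $ a $ j else 0)
     | (Inr (m, j), Inr (m', j')) \<Rightarrow> (if m = m' then G_in $ j $ j' else 0))"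

text \<open>
  The result is \<open>None\<close> if the side condition of a generalized local complementation is violated.
\<close>

definition local_complementation ::
  "'v \<Rightarrow> 'p::prime_card mod_ring ^ 'v \<Rightarrow> 'p mod_ring ^ 'v ^ 'v \<Rightarrow>
   ('p mod_ring ^ 'v ^ 'v) option" where
  "local_complementation i v F =
     (if \<forall>j. j = i \<or> F $ i $ j \<noteq> 0 \<longrightarrow> v $ j = 0
      then Some (\<chi> a b. F $ a $ b + v $ a * F $ i $ b + F $ i $ a * v $ b)
      else None)"

primrec local_complementations ::
  "('v \<Rightarrow> 'p::prime_card mod_ring ^ 'v) \<Rightarrow> 'v list \<Rightarrow> 'p mod_ring ^ 'v ^ 'v \<Rightarrow>
   ('p mod_ring ^ 'v ^ 'v) option" where
  "local_complementations V [] F = Some F"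
| "local_complementations V (i # is) F =
     Option.bind (local_complementation i (V i) F) (local_complementations V is)"

definition output_labels ::
  "'p::prime_card mod_ring ^ ('a::finite + 'b::finite) ^ ('a + 'b) \<Rightarrow> 'a + 'b \<Rightarrow> 'p mod_ring ^ ('a + 'b)" where
  "output_labels F i = (\<chi> w. case w of Inl _ \<Rightarrow> 0 | Inr y \<Rightarrow> F $ i $ Inr y)"

definition delete_cross_edges ::
  "'p::prime_card mod_ring ^ ('a::finite + 'b::finite) ^ ('a + 'b) \<Rightarrow> 'p mod_ring ^ ('a + 'b) ^ ('a + 'b)" where
  "delete_cross_edges F = (\<chi> u w. if isl u = isl w then F $ u $ w else 0)"

definition remove_auxiliary ::
  "'p::prime_card mod_ring ^ ('a::finite + 'b::finite) ^ ('a + 'b) \<Rightarrow> 'p mod_ring ^ 'b ^ 'b" where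
  "remove_auxiliary F = (\<chi> y z. F $ Inr y $ Inr z)"

text \<open>The list \<open>is\<close> gives the order in which the auxiliary vertices are processed.\<close>

definition graph_concatenation ::
  "'p::prime_card mod_ring ^ ('a::finite + 'b::finite) ^ ('a + 'b) \<Rightarrow> 'a list \<Rightarrow>
   ('p mod_ring ^ 'b ^ 'b) option" where
  "graph_concatenation F is =
     map_option remove_auxiliary
       (local_complementations (output_labels F) (map Inl is) (delete_cross_edges F))"

end

theory Submission
  imports Defs
begin

text \<open>
  Up to a scalar, the graph state of \<open>G\<close> has the amplitude $\omega^{q_G(s)}$ at \<open>s\<close>, where
  $q_G(s) = \sum_{i<j} g_{ij} s_i s_j$, and orthogonality of characters turns the inner encoder into
  $(E\phi)(z) \propto \psi_{in}(z)\,\phi(A z)$. With \<open>B\<close> the block diagonal matrix whose blocks are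
  all \<open>A\<close>, the image of the outer graph state therefore has the phase
  $q_{out}(B z) + \sum_m q_{in}(z_m)$. Since the outer graph has no edges inside a block, this
  is \<open>q\<close> for the adjacency matrix $I \otimes G_{in} + B^T G_{out} B$, and $Z^c$ is carried to
  $Z^{cB}$. Processing the auxiliary vertices in any order adds every term of $B^T G_{out} B$ once,
  when the second end of the corresponding edge of the outer graph is processed.
\<close>


subsection \<open>Characters of the prime field\<close>

lemma of_nat_residue [simp]: "of_nat (residue r) = r"
  for r :: "'p::prime_card mod_ring"
  unfolding residue_def of_nat_of_int_mod_ring o_def
  by (metis Rep_mod_ring atLeastLessThan_iff int_nat_eq of_int_mod_ring_to_int_mod_ring to_int_mod_ring.rep_eq)

lemma residue_0 [simp]: "residue (0 :: 'p::prime_card mod_ring) = 0"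
  by (simp add: residue_def)

lemma residue_1 [simp]: "residue (1 :: 'p::prime_card mod_ring) = 1"
  by (simp add: residue_def)

lemma unit_root_power_card: "exp (2 * of_real pi * \<i> / of_nat CARD('p::prime_card)) ^ CARD('p) = 1"
proof -
  have "exp (2 * of_real pi * \<i> / of_nat CARD('p)) ^ CARD('p) =
      exp (of_nat CARD('p) * (2 * of_real pi * \<i> / of_nat CARD('p)))"
    by (rule exp_of_nat_mult[symmetric])
  also have "\<dots> = exp (2 * of_real pi * \<i>)"
    by simp
  finally show ?thesis by simp
qed

text \<open>The p-th power of the root is \<open>1\<close>, so exponents count only modulo p and may
  be read off any representative. This is what makes \<open>omega_pow\<close> a character.\<close>

lemma omega_pow_of_nat:
  "omega_pow (of_nat e :: 'p::prime_card mod_ring) =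
     exp (2 * of_real pi * \<i> / of_nat CARD('p)) ^ e"
proof -
  let ?w = "exp (2 * of_real pi * \<i> / of_nat CARD('p)) :: complex"
  have "residue (of_nat e :: 'p mod_ring) = e mod CARD('p)"
    unfolding residue_def of_nat_of_int_mod_ring o_def
    by (simp add: of_int_mod_ring.rep_eq to_int_mod_ring.rep_eq nat_mod_distrib)
  moreover have "?w ^ e = ?w ^ (CARD('p) * (e div CARD('p)) + e mod CARD('p))"
    by simp
  moreover have "\<dots> = ?w ^ (e mod CARD('p))"
    by (simp only: power_add power_mult unit_root_power_card power_one mult_1_left)
  ultimately show ?thesis
    by (simp add: omega_pow_def)
qed

lemma omega_pow_add: "omega_pow (a + b) = omega_pow a * omega_pow b"
  for a b :: "'p::prime_card mod_ring"
  using omega_pow_of_nat[of "residue a + residue b", where ?'p = 'p]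
  by (simp add: power_add omega_pow_def)

lemma omega_pow_0 [simp]: "omega_pow (0 :: 'p::prime_card mod_ring) = 1"
  by (simp add: omega_pow_def)

lemma omega_pow_nonzero [simp]: "omega_pow (a :: 'p::prime_card mod_ring) \<noteq> 0"
  by (simp add: omega_pow_def)

lemma omega_pow_sum: "omega_pow (\<Sum>i\<in>S. f i) = (\<Prod>i\<in>S. omega_pow (f i :: 'p::prime_card mod_ring))"
  by (induction S rule: infinite_finite_induct) (auto simp: omega_pow_add)

lemma omega_pow_1_neq_1: "omega_pow (1 :: 'p::prime_card mod_ring) \<noteq> 1"
proof -
  have "1 < CARD('p)"
    using prime_card[where ?'a = 'p] prime_gt_1_nat by blast
  have "exp (2 * of_real pi * \<i> * of_nat 1 / of_nat CARD('p)) = (1::complex) \<longleftrightarrow> CARD('p) dvd 1"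
    by (rule complex_root_unity_eq_1) (use \<open>1 < CARD('p)\<close> in simp)
  with \<open>1 < CARD('p)\<close> show ?thesis
    by (simp add: omega_pow_def)
qed

text \<open>For nonzero \<open>x\<close>, translating \<open>r\<close> by a \<open>t\<close> whose
  pairing with \<open>x\<close> is \<open>1\<close> permutes the range and multiplies the sum by
  \<open>omega_pow 1\<close>, which is not \<open>1\<close>. Hence the sum vanishes.\<close>

lemma sum_omega_pow:
  fixes x :: "('p::prime_card, 'v::finite) fvec"
  shows "(\<Sum>r\<in>UNIV. omega_pow (\<Sum>i\<in>UNIV. x $ i * r $ i)) = (if x = 0 then of_nat (CARD('p) ^ CARD('v)) else 0)"
proof (cases "x = 0")
  case False
  then obtain a where a: "x $ a \<noteq> 0"
    by (auto simp: vec_eq_iff)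
  define t :: "('p, 'v) fvec" where "t = axis a (inverse (x $ a))"
  have t: "(\<Sum>i\<in>UNIV. x $ i * t $ i) = 1"
    using a by (simp add: t_def axis_def if_distrib cong: if_cong)
  let ?S = "\<Sum>r\<in>UNIV. omega_pow (\<Sum>i\<in>UNIV. x $ i * r $ i)"
  have "?S = (\<Sum>r\<in>UNIV. omega_pow (\<Sum>i\<in>UNIV. x $ i * (r + t) $ i))"
    by (rule sum.reindex_bij_witness[where i = "\<lambda>r. r + t" and j = "\<lambda>r. r - t"]) auto
  also have "\<dots> = ?S * omega_pow (1 :: 'p mod_ring)"
    by (simp add: distrib_left sum.distrib t omega_pow_add sum_distrib_right)
  finally have "?S * (omega_pow (1 :: 'p mod_ring) - 1) = 0"
    by (simp add: algebra_simps)
  with omega_pow_1_neq_1[where ?'p = 'p] False show ?thesis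
    by simp
qed simp


subsection \<open>Pauli operators\<close>

definition dot_product :: "('p::prime_card, 'v::finite) fvec \<Rightarrow> ('p, 'v) fvec \<Rightarrow> 'p mod_ring" where
  "dot_product x y = (\<Sum>i\<in>UNIV. x $ i * y $ i)"

lemma dot_product_commute: "dot_product x y = dot_product y x"
  by (simp add: dot_product_def mult.commute)

lemma dot_product_add_right: "dot_product x (y + z) = dot_product x y + dot_product x z"
  by (simp add: dot_product_def distrib_left sum.distrib)

lemma dot_product_vector_matrix: "dot_product (x v* A) y = dot_product x (A *v y)"
proof -
  have "dot_product (x v* A) y = (\<Sum>j\<in>UNIV. \<Sum>i\<in>UNIV. x $ i * (A $ i $ j * y $ j))"
    by (simp add: dot_product_def vector_matrix_mult_def sum_distrib_right mult.assoc)
  also have "\<dots> = dot_product x (A *v y)"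
    by (subst sum.swap) (simp add: dot_product_def matrix_vector_mult_def sum_distrib_left)
  finally show ?thesis .
qed

lemma matrix_pow_X: "matrix_pow X_qupit e $ s $ r = (if s = r + of_nat e then 1 else 0)"
  for s r :: "'p::prime_card mod_ring"
proof (induction e arbitrary: s)
  case 0
  then show ?case by (simp add: matrix_pow_def mat_def)
next
  case (Suc e)
  have "matrix_pow X_qupit (Suc e) $ s $ r = (\<Sum>k\<in>UNIV. X_qupit $ s $ k * matrix_pow X_qupit e $ k $ r)"
    by (simp add: matrix_pow_def matrix_matrix_mult_def)
  also have "\<dots> = (\<Sum>k\<in>UNIV. if k = r + of_nat e then X_qupit $ s $ k else 0)"
    by (rule sum.cong) (auto simp: Suc)
  also have "\<dots> = (if s = r + of_nat (Suc e) then 1 else 0)"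
    by (simp add: X_qupit_def algebra_simps)
  finally show ?case .
qed

lemma matrix_pow_Z: "matrix_pow Z_qupit e $ s $ r = (if s = r then omega_pow r ^ e else 0)"
  for s r :: "'p::prime_card mod_ring"
proof (induction e arbitrary: s)
  case 0
  then show ?case by (simp add: matrix_pow_def mat_def)
next
  case (Suc e)
  have "matrix_pow Z_qupit (Suc e) $ s $ r = (\<Sum>k\<in>UNIV. Z_qupit $ s $ k * matrix_pow Z_qupit e $ k $ r)"
    by (simp add: matrix_pow_def matrix_matrix_mult_def)
  also have "\<dots> = (\<Sum>k\<in>UNIV. if k = r then Z_qupit $ s $ k * omega_pow r ^ e else 0)"
    by (rule sum.cong) (auto simp: Suc)
  also have "\<dots> = (if s = r then omega_pow r ^ Suc e else 0)"
    by (simp add: Z_qupit_def)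
  finally show ?case .
qed

lemma omega_pow_power: "omega_pow r ^ e = omega_pow (of_nat e * r)"
  for r :: "'p::prime_card mod_ring"
  by (induction e) (simp_all add: omega_pow_add distrib_right)

text \<open>Collapses a tensor product of coordinatewise Kronecker deltas into a single delta
  between basis vectors.\<close>

lemma prod_if_all:
  fixes f :: "'a::finite \<Rightarrow> 'b::comm_semiring_1"
  shows "(\<Prod>i\<in>UNIV. if P i then f i else 0) = (if \<forall>i. P i then \<Prod>i\<in>UNIV. f i else 0)"
  by (auto intro!: prod_zero prod.cong)

lemma pauli_X_nth: "pauli_X a $ s $ r = (if s = r + a then 1 else 0)"
  for s r :: "('p::prime_card, 'v::finite) fvec"
  by (simp add: pauli_X_def tensor_operators_def matrix_pow_X prod_if_all vec_eq_iff)

lemma pauli_Z_nth: "pauli_Z b $ s $ r = (if s = r then omega_pow (\<Sum>i\<in>UNIV. b $ i * r $ i) else 0)"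
  for s r :: "('p::prime_card, 'v::finite) fvec"
  by (simp add: pauli_Z_def tensor_operators_def matrix_pow_Z prod_if_all vec_eq_iff
      omega_pow_power omega_pow_sum)

lemma pauli_X_mult: "(pauli_X a *v \<phi>) $ s = \<phi> $ (s - a)"
proof -
  have "pauli_X a $ s $ r * \<phi> $ r = (if r = s - a then \<phi> $ r else 0)" for r
    by (auto simp: pauli_X_nth)
  then show ?thesis
    by (simp add: matrix_vector_mult_def)
qed

lemma pauli_Z_mult: "(pauli_Z b *v \<phi>) $ s = omega_pow (dot_product b s) * \<phi> $ s"
proof -
  have "pauli_Z b $ s $ r * \<phi> $ r = (if r = s then omega_pow (dot_product b r) * \<phi> $ r else 0)" for r
    by (auto simp: pauli_Z_nth dot_product_def)
  then show ?thesis
    by (simp add: matrix_vector_mult_def)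
qed


subsection \<open>Explicit graph states\<close>

text \<open>
  The sum over the edges. An enumeration of the vertices picks each edge once; halving the full
  quadratic form is impossible for \<open>p = 2\<close>.
\<close>

definition edge_form :: "'p::prime_card mod_ring ^ 'v ^ 'v \<Rightarrow> ('p, 'v::finite) fvec \<Rightarrow> 'p mod_ring" where
  "edge_form G s = (\<Sum>i\<in>UNIV. \<Sum>j\<in>UNIV. if to_nat i < to_nat j then G $ i $ j * s $ i * s $ j else 0)"

lemma labeled_graph_sym: "labeled_graph G \<Longrightarrow> G $ i $ j = G $ j $ i"
  unfolding labeled_graph_def transpose_def by (metis vec_lambda_beta)

lemma edge_form_0 [simp]: "edge_form G 0 = 0"
  by (simp add: edge_form_def cong: if_cong)

text \<open>Polarization: by symmetry of \<open>G\<close>, the mixed terms of one kind run over the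
  pairs with i before j and those of the other kind over the reversed pairs. The zero diagonal
  supplies the pairs i = j, and the full bilinear form results.\<close>

lemma edge_form_add:
  assumes "labeled_graph G"
  shows "edge_form G (s + t) = edge_form G s + edge_form G t + dot_product s (G *v t)"
proof -
  have sym: "G $ i $ j = G $ j $ i" for i j
    using assms by (rule labeled_graph_sym)
  have diag: "G $ i $ i = 0" for i
    using assms by (simp add: labeled_graph_def)
  let ?m = "\<lambda>s t. \<Sum>i\<in>UNIV. \<Sum>j\<in>UNIV. if to_nat i < to_nat j then G $ i $ j * s $ i * t $ j else 0"
  have "edge_form G (s + t) = edge_form G s + edge_form G t + (?m s t + ?m t s)"
    unfolding edge_form_def sum.distrib[symmetric]
    by (intro sum.cong refl) (simp add: distrib_left distrib_right)
  also have "?m t s = (\<Sum>i\<in>UNIV. \<Sum>j\<in>UNIV. if to_nat j < to_nat i then G $ i $ j * s $ i * t $ j else 0)"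
  proof (subst sum.swap, intro sum.cong refl)
    fix i j
    show "(if to_nat j < to_nat i then G $ j $ i * t $ j * s $ i else 0) =
        (if to_nat j < to_nat i then G $ i $ j * s $ i * t $ j else 0)"
      using sym[of i j] by (simp add: mult.assoc mult.commute)
  qed
  also have "?m s t + \<dots> = (\<Sum>i\<in>UNIV. \<Sum>j\<in>UNIV. G $ i $ j * s $ i * t $ j)"
    unfolding sum.distrib[symmetric]
  proof (intro sum.cong refl)
    fix i j
    show "(if to_nat i < to_nat j then G $ i $ j * s $ i * t $ j else 0) +
        (if to_nat j < to_nat i then G $ i $ j * s $ i * t $ j else 0) = G $ i $ j * s $ i * t $ j"
      by (cases "to_nat i" "to_nat j" rule: linorder_cases) (auto simp: diag)
  qed
  also have "\<dots> = dot_product s (G *v t)"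
    by (simp add: dot_product_def matrix_vector_mult_def sum_distrib_left mult_ac)
  finally show ?thesis .
qed

text \<open>Only edges inside the support of \<open>s\<close> contribute. This is applied to single
  vertices and to vectors supported in one block.\<close>

lemma edge_form_eq_0:
  assumes "\<And>i j. s $ i \<noteq> 0 \<Longrightarrow> s $ j \<noteq> 0 \<Longrightarrow> G $ i $ j = 0"
  shows "edge_form G s = 0"
  unfolding edge_form_def using assms by (intro sum.neutral ballI) auto

text \<open>The standard basis vectors generate the additive group, so a vector is reached from
  \<open>0\<close> by unit steps, one coordinate after the other.\<close>

lemma translation_invariant_imp_const:
  fixes f :: "('p::prime_card, 'v::finite) fvec \<Rightarrow> 'b"
  assumes "\<And>s i. f (s + axis i 1) = f s"
  shows "f s = f 0"
proof -
  \<comment> \<open>Every field element is a natural multiple of \<open>1\<close>, so repeated unit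
    steps cover a whole coordinate direction.\<close>
  have mult: "f (t + axis i (of_nat e)) = f t" for t i e
  proof (induction e)
    case (Suc e)
    have "axis i (of_nat (Suc e)) = axis i (of_nat e) + (axis i 1 :: ('p, 'v) fvec)"
      by (simp add: vec_eq_iff axis_def)
    then have "f (t + axis i (of_nat (Suc e))) = f ((t + axis i (of_nat e)) + axis i 1)"
      by (simp only: add.assoc)
    with assms Suc show ?case by simp
  qed (simp add: axis_def vec_eq_iff zero_vec_def[symmetric])
  have "f (t + (\<Sum>i\<in>S. axis i (s $ i))) = f t" if "finite S" for t S
    using that
  proof (induction S arbitrary: t)
    case (insert i S)
    then show ?case
      using mult[of t i "residue (s $ i)"] by (simp add: add.assoc[symmetric])
  qed simp
  moreover have "(\<Sum>i\<in>UNIV. axis i (s $ i)) = s"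
    by (simp add: vec_eq_iff axis_def)
  ultimately show ?thesis
    by (metis add_0 finite)
qed

lemma edge_form_axis:
  assumes "labeled_graph G"
  shows "edge_form G (axis i c) = 0"
  using assms by (intro edge_form_eq_0) (auto simp: axis_def labeled_graph_def split: if_splits)

lemma matrix_vector_mult_axis: "(M *v axis i 1) $ j = M $ j $ i"
  for M :: "'a::semiring_1 ^ 'v::finite ^ 'w"
proof -
  have "M $ j $ l * (if l = i then 1 else 0) = (if l = i then M $ j $ l else 0)" for l
    by simp
  then show ?thesis
    by (simp add: matrix_vector_mult_def axis_def)
qed

lemma edge_form_add_axis:
  assumes "labeled_graph G"
  shows "edge_form G (s + axis i 1) = edge_form G s + dot_product (row i G) s"
proof -
  have "dot_product s (G *v axis i 1) = dot_product (row i G) s"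
    using labeled_graph_sym[OF assms, of i]
    by (simp add: dot_product_def matrix_vector_mult_axis row_def mult.commute)
  then show ?thesis
    by (simp add: edge_form_add[OF assms] edge_form_axis[OF assms])
qed

text \<open>Left unnormalized: every amplitude is a pure phase, and scalars disappear in the
  spans.\<close>

definition graph_vector :: "'p::prime_card mod_ring ^ 'v ^ 'v \<Rightarrow> ('p, 'v::finite) state" where
  "graph_vector G = (\<chi> s. omega_pow (edge_form G s))"

text \<open>The Z part multiplies the amplitude at \<open>s\<close> by a phase and the X part then
  moves it to \<open>s + axis i 1\<close>. Being fixed is thus a recurrence along direction
  \<open>i\<close>, which \<open>edge_form_add_axis\<close> solves.\<close>

lemma stabilizer_iff:
  "(pauli_X (axis i 1) ** pauli_Z (row i G)) *v \<psi> = \<psi> \<longleftrightarrow>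
     (\<forall>s. \<psi> $ (s + axis i 1) = omega_pow (dot_product (row i G) s) * \<psi> $ s)"
proof
  assume *: "(pauli_X (axis i 1) ** pauli_Z (row i G)) *v \<psi> = \<psi>"
  show "\<forall>s. \<psi> $ (s + axis i 1) = omega_pow (dot_product (row i G) s) * \<psi> $ s"
    by (subst *[symmetric])
       (simp add: matrix_vector_mul_assoc[symmetric] pauli_X_mult pauli_Z_mult)
next
  assume *: "\<forall>s. \<psi> $ (s + axis i 1) = omega_pow (dot_product (row i G) s) * \<psi> $ s"
  have "omega_pow (dot_product (row i G) (s - axis i 1)) * \<psi> $ (s - axis i 1) = \<psi> $ s" for s
    using *[rule_format, of "s - axis i 1"] by simp
  then show "(pauli_X (axis i 1) ** pauli_Z (row i G)) *v \<psi> = \<psi>"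
    by (simp add: vec_eq_iff matrix_vector_mul_assoc[symmetric] pauli_X_mult pauli_Z_mult)
qed

text \<open>Dividing \<psi> by the phases of \<open>graph_vector G\<close> cancels the factor in the
  recurrence, so the quotient is constant; norm one excludes the constant \<open>0\<close>.\<close>

lemma is_graph_state_imp_scaled:
  assumes G: "labeled_graph G" and "is_graph_state G \<psi>"
  shows "\<exists>c. c \<noteq> 0 \<and> \<psi> = c *s graph_vector G"
proof -
  have norm: "norm \<psi> = 1" and step: "\<psi> $ (s + axis i 1) = omega_pow (dot_product (row i G) s) * \<psi> $ s" for s i
    using assms(2) by (auto simp: is_graph_state_def stabilizer_iff)
  define f where "f s = \<psi> $ s / omega_pow (edge_form G s)" for s
  have "f (s + axis i 1) = f s" for s i
    by (simp add: f_def step edge_form_add_axis[OF G] omega_pow_add)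
  then have const: "f s = f 0" for s
    by (rule translation_invariant_imp_const)
  have "\<psi> $ s = f 0 * omega_pow (edge_form G s)" for s
    by (subst const[of s, symmetric]) (simp add: f_def)
  then have "\<psi> = f 0 *s graph_vector G"
    by (simp add: vec_eq_iff graph_vector_def)
  moreover from this norm have "f 0 \<noteq> 0"
    by auto
  ultimately show ?thesis by blast
qed

lemma graph_state_exists:
  assumes "labeled_graph G"
  shows "\<exists>\<psi>. is_graph_state G \<psi>"
proof -
  let ?N = "norm (graph_vector G)"
  have "graph_vector G $ 0 \<noteq> 0"
    by (simp add: graph_vector_def)
  then have "?N \<noteq> 0"
    by auto
  then have "is_graph_state G ((1 / ?N) *\<^sub>R graph_vector G)"
    unfolding is_graph_state_def stabilizer_iff
    by (simp add: graph_vector_def edge_form_add_axis[OF assms] omega_pow_add)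
  then show ?thesis by blast
qed

lemma graph_state_scaled:
  assumes "labeled_graph G"
  obtains c where "c \<noteq> 0" and "graph_state G = c *s graph_vector G"
  using is_graph_state_imp_scaled[OF assms someI_ex[OF graph_state_exists[OF assms]]]
  unfolding graph_state_def by blast


subsection \<open>The concatenated encoder\<close>

text \<open>The Kronecker product of an identity matrix with \<open>A\<close>. Rectangular blocks
  are allowed so that it covers both the copies of the inner graph and those of the generator
  matrix.\<close>

definition block_diagonal :: "'a::zero ^ 'n ^ 'k \<Rightarrow> 'a ^ ('m::finite \<times> 'n::finite) ^ ('m \<times> 'k::finite)" where
  "block_diagonal A = (\<chi> u w. if fst u = fst w then A $ snd u $ snd w else 0)"

lemma sum_UNIV_prod:
  "(\<Sum>u\<in>UNIV. f u) = (\<Sum>m\<in>UNIV. \<Sum>a\<in>UNIV. f (m, a))"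
  for f :: "'m::finite \<times> 'k::finite \<Rightarrow> 'b::comm_monoid_add"
  by (simp add: sum.cartesian_product UNIV_Times_UNIV[symmetric] del: UNIV_Times_UNIV)

lemma block_eq_iff: "x = y \<longleftrightarrow> (\<forall>m. block x m = block y m)"
  by (auto simp: block_def vec_eq_iff)

lemma block_join_blocks [simp]: "block (join_blocks c) m = c $ m"
  by (simp add: block_def join_blocks_def vec_eq_iff)

lemma block_add: "block (x + y) m = block x m + block y m"
  by (simp add: block_def vec_eq_iff)

lemma block_block_diagonal_mult:
  "block (block_diagonal A *v z) m = A *v block z m"
  for A :: "'a::semiring_1 ^ 'n::finite ^ 'k::finite"
proof -
  have "(\<Sum>m'\<in>UNIV. \<Sum>j\<in>UNIV. (if m = m' then A $ a $ j else 0) * z $ (m', j)) =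
      (\<Sum>m'\<in>UNIV. if m = m' then \<Sum>j\<in>UNIV. A $ a $ j * z $ (m', j) else 0)" for a
    by (rule sum.cong) auto
  then show ?thesis
    by (simp add: vec_eq_iff block_def block_diagonal_def matrix_vector_mult_def sum_UNIV_prod cong: if_cong)
qed

lemma block_mult_block_diagonal:
  "block (x v* block_diagonal A) m = block x m v* A"
  for A :: "'a::semiring_1 ^ 'n::finite ^ 'k::finite"
proof -
  have "(\<Sum>m'\<in>UNIV. \<Sum>i\<in>UNIV. x $ (m', i) * (if m' = m then A $ i $ j else 0)) =
      (\<Sum>m'\<in>UNIV. if m' = m then \<Sum>i\<in>UNIV. x $ (m', i) * A $ i $ j else 0)" for j
    by (rule sum.cong) auto
  then show ?thesis
    by (simp add: vec_eq_iff block_def block_diagonal_def vector_matrix_mult_def sum_UNIV_prod cong: if_cong)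
qed

text \<open>Blockwise encoding is one multiplication by the block diagonal matrix, the form in which
  codewords reappear as exponents of Z.\<close>

lemma classical_concatenation_eq:
  "classical_concatenation A C = (\<lambda>c. c v* block_diagonal A) ` join_blocks ` C"
proof -
  have "join_blocks (\<chi> m. (c $ m) v* A) = join_blocks c v* block_diagonal A" for c
    by (simp add: block_eq_iff[of "join_blocks _"] block_mult_block_diagonal)
  then show ?thesis
    by (auto simp: classical_concatenation_def)
qed

text \<open>Summing the characters over \<open>r\<close> turns the encoder into evaluation at \<open>A z\<close>.\<close>

lemma inner_encoder_nth:
  fixes G :: "'p::prime_card mod_ring ^ 'n::finite ^ 'n" and A :: "'p mod_ring ^ 'n ^ 'k::finite"
  shows "inner_encoder G A $ z $ x =
    (if x = A *v z
     then of_real (real CARD('p) powr (- real CARD('k) / 2)) * of_nat (CARD('p) ^ CARD('k)) * graph_state G $ z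
     else 0)"
proof -
  let ?c = "of_real (real CARD('p) powr (- real CARD('k) / 2)) :: complex"
  have exponent: "- (\<Sum>a\<in>UNIV. x $ a * r $ a) + dot_product (r v* A) z = (\<Sum>a\<in>UNIV. (A *v z - x) $ a * r $ a)" for r
    unfolding dot_product_vector_matrix by (simp add: dot_product_def algebra_simps sum_subtractf)
  have "inner_encoder G A $ z $ x =
      ?c * (\<Sum>r\<in>UNIV. omega_pow (- (\<Sum>a\<in>UNIV. x $ a * r $ a) + dot_product (r v* A) z) * graph_state G $ z)"
    unfolding inner_encoder_def encoded_basis_state_def
    by (simp add: pauli_Z_mult omega_pow_add mult.assoc del: uminus_add_conv_diff)
  also have "\<dots> = ?c * ((\<Sum>r\<in>UNIV. omega_pow (\<Sum>a\<in>UNIV. (A *v z - x) $ a * r $ a)) * graph_state G $ z)"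
    by (simp only: exponent sum_distrib_right)
  finally show ?thesis
    by (simp only: sum_omega_pow) simp
qed

text \<open>Each tensor factor is a delta at \<open>A *v block z m\<close>, so their product leaves
  only the basis state \<open>block_diagonal A *v z\<close>.\<close>

lemma tensor_power_inner_encoder_mult:
  fixes G :: "'p::prime_card mod_ring ^ 'n::finite ^ 'n" and A :: "'p mod_ring ^ 'n ^ 'k::finite"
  assumes "labeled_graph G"
  obtains c :: complex where "c \<noteq> 0"
    and "\<And>\<phi> z. (tensor_power (inner_encoder G A) *v \<phi> :: ('p, 'm::finite \<times> 'n) state) $ z =
      c * omega_pow (\<Sum>m\<in>UNIV. edge_form G (block z m)) * \<phi> $ (block_diagonal A *v z)"
proof -
  obtain d where d: "d \<noteq> 0" "graph_state G = d *s graph_vector G"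
    by (rule graph_state_scaled[OF assms])
  define e :: complex where
    "e = of_real (real CARD('p) powr (- real CARD('k) / 2)) * of_nat (CARD('p) ^ CARD('k))"
  have e: "e \<noteq> 0" "inner_encoder G A $ z $ x = (if x = A *v z then e * graph_state G $ z else 0)" for z x
    by (simp_all add: e_def inner_encoder_nth)
  \<comment> \<open>Each block contributes \<open>e\<close> from the character sum and its
    prefactor, and \<open>d\<close> from the scaling of the inner graph state.\<close>
  let ?c = "(e * d) ^ CARD('m)"
  have entry: "(tensor_power (inner_encoder G A) :: ('p, 'm \<times> 'k, 'm \<times> 'n) operator) $ z $ x * \<phi> $ x =
      (if x = block_diagonal A *v z
       then ?c * omega_pow (\<Sum>m\<in>UNIV. edge_form G (block z m)) * \<phi> $ x else 0)" for z x \<phi>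
    by (simp add: tensor_power_def e d graph_vector_def prod_if_all block_eq_iff[of x]
        block_block_diagonal_mult prod.distrib omega_pow_sum power_mult_distrib)
  show thesis
  proof (rule that[of ?c])
    show "(tensor_power (inner_encoder G A) *v \<phi> :: ('p, 'm \<times> 'n) state) $ z =
      ?c * omega_pow (\<Sum>m\<in>UNIV. edge_form G (block z m)) * \<phi> $ (block_diagonal A *v z)" for \<phi> z
      unfolding matrix_vector_mult_def vec_lambda_beta entry
      unfolding matrix_vector_mult_def[symmetric]
      by simp
  qed (use d e in simp)
qed


subsection \<open>The concatenated graph\<close>

text \<open>The second summand adds up the products of labels along the paths output - auxiliary -
  auxiliary - output in the encoding graph.\<close>

definition concatenated_graph ::
  "'p::prime_card mod_ring ^ ('m::finite \<times> 'k::finite) ^ ('m \<times> 'k) \<Rightarrow>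
   'p mod_ring ^ 'n::finite ^ 'n \<Rightarrow> 'p mod_ring ^ 'n ^ 'k \<Rightarrow>
   'p mod_ring ^ ('m \<times> 'n) ^ ('m \<times> 'n)" where
  "concatenated_graph G_out G_in A =
     block_diagonal G_in + transpose (block_diagonal A) ** G_out ** block_diagonal A"

lemma concatenated_graph_nth:
  "concatenated_graph G_out G_in A $ y $ z = block_diagonal G_in $ y $ z +
     (\<Sum>i\<in>UNIV. \<Sum>j\<in>UNIV. block_diagonal A $ i $ y * G_out $ i $ j * block_diagonal A $ j $ z)"
proof -
  have "(transpose (block_diagonal A) ** G_out ** block_diagonal A) $ y $ z =
      (\<Sum>j\<in>UNIV. \<Sum>i\<in>UNIV. block_diagonal A $ i $ y * G_out $ i $ j * block_diagonal A $ j $ z)"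
    by (simp add: matrix_matrix_mult_def transpose_def sum_distrib_right)
  then show ?thesis
    by (subst sum.swap) (simp add: concatenated_graph_def)
qed

lemma transpose_add: "transpose (M + N) = transpose M + transpose N"
  by (simp add: transpose_def vec_eq_iff)

text \<open>A diagonal term would need an outer edge between two auxiliary vertices joined to the
  same output vertex. These lie in one block, where the outer graph has no edges.\<close>

lemma labeled_graph_concatenated_graph:
  fixes G_out :: "'p::prime_card mod_ring ^ ('m::finite \<times> 'k::finite) ^ ('m \<times> 'k)"
    and G_in :: "'p mod_ring ^ 'n::finite ^ 'n" and A :: "'p mod_ring ^ 'n ^ 'k"
  assumes "labeled_graph G_in" "labeled_graph G_out" "\<And>m a b. G_out $ (m, a) $ (m, b) = 0"
  shows "labeled_graph (concatenated_graph G_out G_in A)"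
proof -
  have "transpose (concatenated_graph G_out G_in A) = concatenated_graph G_out G_in A"
  proof -
    have "transpose (block_diagonal G_in) = block_diagonal G_in"
      using labeled_graph_sym[OF assms(1)] by (simp add: transpose_def block_diagonal_def vec_eq_iff)
    moreover have "transpose G_out = G_out"
      using assms(2) by (simp add: labeled_graph_def)
    ultimately show ?thesis
      by (simp add: concatenated_graph_def transpose_add matrix_transpose_mul matrix_mul_assoc)
  qed
  moreover have "concatenated_graph G_out G_in A $ y $ y = 0" for y
  proof -
    have "block_diagonal A $ i $ y * G_out $ i $ j * block_diagonal A $ j $ y = 0" for i j
      using assms(3)[of "fst i" "snd i" "snd j"] by (cases i; cases j) (auto simp: block_diagonal_def)
    moreover have "block_diagonal G_in $ y $ y = 0"
      using assms(1) by (simp add: block_diagonal_def labeled_graph_def)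
    ultimately show ?thesis
      by (simp only: concatenated_graph_nth sum.neutral_const add_0_right)
  qed
  ultimately show ?thesis
    by (simp add: labeled_graph_def)
qed

lemma dot_product_blocks: "dot_product x y = (\<Sum>m\<in>UNIV. dot_product (block x m) (block y m))"
  by (simp add: dot_product_def block_def sum_UNIV_prod)

lemma dot_product_transpose: "dot_product s (transpose B *v y) = dot_product (B *v s) y"
  by (metis dot_product_commute dot_product_vector_matrix vector_transpose_matrix)

lemma dot_product_concatenated_graph:
  "dot_product s (concatenated_graph G_out G_in A *v t) =
     (\<Sum>m\<in>UNIV. dot_product (block s m) (G_in *v block t m)) +
     dot_product (block_diagonal A *v s) (G_out *v (block_diagonal A *v t))"
  by (simp del: transpose_matrix_vector add: concatenated_graph_def matrix_vector_mult_add_rdistrib dot_product_add_right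
      matrix_vector_mul_assoc[symmetric] dot_product_transpose
      dot_product_blocks[of s "block_diagonal G_in *v t"] block_block_diagonal_mult)

text \<open>Both sides polarize to the same bilinear form and vanish on basis vectors, so their
  difference is invariant under unit steps and equals its value at \<open>0\<close>. No comparison
  of vertex enumerations is required.\<close>

lemma edge_form_concatenated_graph:
  fixes G_out :: "'p::prime_card mod_ring ^ ('m::finite \<times> 'k::finite) ^ ('m \<times> 'k)"
    and G_in :: "'p mod_ring ^ 'n::finite ^ 'n" and A :: "'p mod_ring ^ 'n ^ 'k"
  assumes "labeled_graph G_in" "labeled_graph G_out" "\<And>m a b. G_out $ (m, a) $ (m, b) = 0"
  shows "edge_form (concatenated_graph G_out G_in A) z =
    edge_form G_out (block_diagonal A *v z) + (\<Sum>m\<in>UNIV. edge_form G_in (block z m))"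
proof -
  let ?G = "concatenated_graph G_out G_in A"
  define Q where "Q z = edge_form G_out (block_diagonal A *v z) + (\<Sum>m\<in>UNIV. edge_form G_in (block z m))" for z
  have G: "labeled_graph ?G"
    by (rule labeled_graph_concatenated_graph[OF assms])
  have block_axis: "block (axis u 1) m = (if m = fst u then axis (snd u) 1 else (0 :: 'p mod_ring ^ 'n))"
    for u :: "'m \<times> 'n" and m
    by (cases u) (auto simp: vec_eq_iff block_def axis_def)
  \<comment> \<open>A single output vertex is joined only to auxiliary vertices of its own block,
    and no outer edge lies inside a block.\<close>
  have Q_axis: "Q (axis u 1) = 0" for u
  proof -
    have "edge_form G_out (block_diagonal A *v axis u 1) = 0"
    proof (rule edge_form_eq_0)
      fix i j
      assume "(block_diagonal A *v axis u 1) $ i \<noteq> 0" "(block_diagonal A *v axis u 1) $ j \<noteq> 0"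
      then have "fst i = fst u" "fst j = fst u"
        by (auto simp: matrix_vector_mult_axis block_diagonal_def split: if_splits)
      then show "G_out $ i $ j = 0"
        using assms(3)[of "fst u" "snd i" "snd j"] by (metis prod.collapse)
    qed
    moreover have "edge_form G_in (block (axis u 1) m) = 0" for m
      by (simp add: block_axis edge_form_axis[OF assms(1)])
    ultimately show ?thesis
      by (simp add: Q_def)
  qed
  have Q_add: "Q (s + t) = Q s + Q t + dot_product s (?G *v t)" for s t
    by (simp add: Q_def matrix_vector_right_distrib block_add edge_form_add[OF assms(1)]
        edge_form_add[OF assms(2)] sum.distrib dot_product_concatenated_graph algebra_simps)
  have "edge_form ?G (s + axis u 1) - Q (s + axis u 1) = edge_form ?G s - Q s" for s u
    by (simp add: Q_add edge_form_add[OF G] Q_axis edge_form_axis[OF G])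
  then have "edge_form ?G z - Q z = edge_form ?G 0 - Q 0"
    by (rule translation_invariant_imp_const)
  also have "\<dots> = 0"
    by (simp add: Q_def block_def zero_vec_def[symmetric])
  finally show ?thesis
    by (simp add: Q_def)
qed


subsection \<open>Graph concatenation\<close>

text \<open>
  The graph reached once the set \<open>S\<close> of auxiliary vertices has been processed, where \<open>G\<close> is the
  graph on the auxiliary vertices, \<open>D\<close> the one on the output vertices and \<open>B\<close> the matrix of the
  deleted edges.
\<close>

definition partial_concatenation ::
  "'p::prime_card mod_ring ^ 'a::finite ^ 'a \<Rightarrow> 'p mod_ring ^ 'b::finite ^ 'b \<Rightarrow> 'p mod_ring ^ 'b ^ 'a \<Rightarrow>
   'a set \<Rightarrow> 'p mod_ring ^ ('a + 'b) ^ ('a + 'b)" where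
  "partial_concatenation G D B S = (\<chi> u w.
     case u of
       Inl i \<Rightarrow> (case w of Inl j \<Rightarrow> G $ i $ j | Inr z \<Rightarrow> \<Sum>l\<in>S. G $ i $ l * B $ l $ z)
     | Inr y \<Rightarrow> (case w of Inl j \<Rightarrow> \<Sum>l\<in>S. G $ j $ l * B $ l $ y
                 | Inr z \<Rightarrow> D $ y $ z + (\<Sum>l\<in>S. \<Sum>l'\<in>S. B $ l $ y * G $ l $ l' * B $ l' $ z)))"

lemma local_complementation_partial_concatenation:
  fixes G :: "'p::prime_card mod_ring ^ 'a::finite ^ 'a"
  assumes G: "labeled_graph G"
    and B: "\<And>l l' y. G $ l $ l' \<noteq> 0 \<Longrightarrow> B $ l' $ y \<noteq> 0 \<Longrightarrow> B $ l $ y = 0"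
    and i: "i \<notin> S"
    and v: "\<And>j. v $ Inl j = 0" "\<And>y. v $ Inr y = B $ i $ y"
  shows "local_complementation (Inl i) v (partial_concatenation G D B S) =
    Some (partial_concatenation G D B (insert i S))"
proof -
  let ?F = "partial_concatenation G D B S"
  have sym: "G $ l $ l' = G $ l' $ l" for l l'
    using G by (rule labeled_graph_sym)
  have diag: "G $ l $ l = 0" for l
    using G by (simp add: labeled_graph_def)
  \<comment> \<open>The side condition: if the row of \<open>i\<close> is nonzero at output
    \<open>y\<close>, some processed neighbour \<open>l\<close> of \<open>i\<close> has a label at
    \<open>y\<close>. Adjacent auxiliary vertices share no output neighbour, so
    \<open>B $ i $ y = 0\<close>.\<close>
  have "v $ w = 0" if "w = Inl i \<or> ?F $ Inl i $ w \<noteq> 0" for w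
  proof (cases w)
    case (Inr y)
    with that have "(\<Sum>l\<in>S. G $ i $ l * B $ l $ y) \<noteq> 0"
      by (simp add: partial_concatenation_def)
    then obtain l where "G $ i $ l * B $ l $ y \<noteq> 0"
      by (rule sum.not_neutral_contains_not_neutral)
    with B[of i l y] Inr show ?thesis
      by (simp add: v)
  qed (simp add: v)
  then have "local_complementation (Inl i) v ?F =
      Some (\<chi> u w. ?F $ u $ w + v $ u * ?F $ Inl i $ w + ?F $ Inl i $ u * v $ w)"
    by (auto simp: local_complementation_def)
  also have "(\<chi> u w. ?F $ u $ w + v $ u * ?F $ Inl i $ w + ?F $ Inl i $ u * v $ w) =
      partial_concatenation G D B (insert i S)"
  proof -
    have "?F $ u $ w + v $ u * ?F $ Inl i $ w + ?F $ Inl i $ u * v $ w =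
        partial_concatenation G D B (insert i S) $ u $ w" for u w
    proof (cases u; cases w)
      fix y z
      assume uw: "u = Inr y" "w = Inr z"
      \<comment> \<open>The new double sum exceeds the old one by the terms with \<open>i\<close> on
        the left and those with \<open>i\<close> on the right; these are the two products added by
        the complementation. The pair of \<open>i\<close> with itself drops out.\<close>
      have "(\<Sum>l\<in>insert i S. \<Sum>l'\<in>insert i S. B $ l $ y * G $ l $ l' * B $ l' $ z) =
          (\<Sum>l\<in>S. \<Sum>l'\<in>S. B $ l $ y * G $ l $ l' * B $ l' $ z) +
          (\<Sum>l'\<in>S. B $ i $ y * G $ i $ l' * B $ l' $ z) +
          (\<Sum>l\<in>S. B $ l $ y * G $ l $ i * B $ i $ z)"
        using i by (simp add: diag sum.distrib)
      moreover have "(\<Sum>l'\<in>S. B $ i $ y * G $ i $ l' * B $ l' $ z) = B $ i $ y * (\<Sum>l\<in>S. G $ i $ l * B $ l $ z)"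
        by (simp add: sum_distrib_left mult.assoc)
      moreover have "(\<Sum>l\<in>S. B $ l $ y * G $ l $ i * B $ i $ z) = (\<Sum>l\<in>S. G $ i $ l * B $ l $ y) * B $ i $ z"
        by (simp add: sum_distrib_left sym[of i] mult_ac)
      ultimately show ?thesis
        by (simp add: uw v partial_concatenation_def)
    \<comment> \<open>Entries between auxiliary vertices stay fixed, and each cross entry gains
      exactly the summand for \<open>i\<close>.\<close>
    qed (use i in \<open>simp_all add: partial_concatenation_def v sym[of _ i] algebra_simps\<close>)
    then show ?thesis
      by (simp add: vec_eq_iff)
  qed
  finally show ?thesis .
qed

text \<open>Each intermediate graph depends only on the set of processed vertices, which gives
  independence of the order.\<close>

lemma local_complementations_partial_concatenation:
  fixes G :: "'p::prime_card mod_ring ^ 'a::finite ^ 'a"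
  assumes "labeled_graph G"
    and "\<And>l l' y. G $ l $ l' \<noteq> 0 \<Longrightarrow> B $ l' $ y \<noteq> 0 \<Longrightarrow> B $ l $ y = 0"
    and "\<And>i j. V (Inl i) $ Inl j = 0" "\<And>i y. V (Inl i) $ Inr y = B $ i $ y"
    and "distinct is" "set is \<inter> S = {}"
  shows "local_complementations V (map Inl is) (partial_concatenation G D B S) =
    Some (partial_concatenation G D B (set is \<union> S))"
  using assms(5,6)
proof (induction "is" arbitrary: S)
  case (Cons i "is")
  have "local_complementation (Inl i) (V (Inl i)) (partial_concatenation G D B S) =
      Some (partial_concatenation G D B (insert i S))"
    by (rule local_complementation_partial_concatenation) (use assms(1-4) Cons.prems in auto)
  with Cons.IH[of "insert i S"] Cons.prems show ?case
    by simp
qed simp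

lemma graph_concatenation_encoding_graph:
  fixes G_out :: "'p::prime_card mod_ring ^ ('m::finite \<times> 'k::finite) ^ ('m \<times> 'k)"
    and G_in :: "'p mod_ring ^ 'n::finite ^ 'n" and A :: "'p mod_ring ^ 'n ^ 'k"
  assumes "labeled_graph G_out" "\<And>m a b. G_out $ (m, a) $ (m, b) = 0"
    and "distinct is" "set is = UNIV"
  shows "graph_concatenation (encoding_graph G_out G_in A) is = Some (concatenated_graph G_out G_in A)"
proof -
  let ?E = "encoding_graph G_out G_in A"
  let ?P = "partial_concatenation G_out (block_diagonal G_in) (block_diagonal A)"
  have "delete_cross_edges ?E = ?P {}"
    by (auto simp: vec_eq_iff delete_cross_edges_def encoding_graph_def partial_concatenation_def
        block_diagonal_def split: sum.split prod.split)
  moreover have "local_complementations (output_labels ?E) (map Inl is) (?P {}) = Some (?P (set is \<union> {}))"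
  proof (rule local_complementations_partial_concatenation[OF assms(1)])
    fix l l' :: "'m \<times> 'k" and y :: "'m \<times> 'n"
    assume "G_out $ l $ l' \<noteq> 0" "(block_diagonal A :: 'p mod_ring ^ ('m \<times> 'n) ^ ('m \<times> 'k)) $ l' $ y \<noteq> 0"
    then show "(block_diagonal A :: 'p mod_ring ^ ('m \<times> 'n) ^ ('m \<times> 'k)) $ l $ y = 0"
      using assms(2)[of "fst l" "snd l" "snd l'"]
      by (cases l; cases l') (auto simp: block_diagonal_def split: if_splits)
  qed (auto simp: output_labels_def encoding_graph_def block_diagonal_def assms split: prod.split)
  moreover have "remove_auxiliary (?P UNIV) = concatenated_graph G_out G_in A"
    by (simp add: vec_eq_iff remove_auxiliary_def partial_concatenation_def concatenated_graph_nth)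
  ultimately show ?thesis
    by (simp add: graph_concatenation_def assms)
qed


subsection \<open>The concatenated code\<close>

text \<open>At \<open>z\<close> the quadratic phases combine by
  \<open>edge_form_concatenated_graph\<close>, and transposing the block diagonal matrix turns the
  linear phase of \<open>c\<close> at its image into that of \<open>c v* block_diagonal A\<close> at
  \<open>z\<close>.\<close>

lemma tensor_power_inner_encoder_graph_state:
  fixes G_out :: "'p::prime_card mod_ring ^ ('m::finite \<times> 'k::finite) ^ ('m \<times> 'k)"
    and G_in :: "'p mod_ring ^ 'n::finite ^ 'n" and A :: "'p mod_ring ^ 'n ^ 'k"
  assumes "labeled_graph G_in" "labeled_graph G_out" "\<And>m a b. G_out $ (m, a) $ (m, b) = 0"
  obtains d where "d \<noteq> 0"
    and "\<And>c. tensor_power (inner_encoder G_in A) *v (pauli_Z c *v graph_state G_out) =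
      d *s (pauli_Z (c v* block_diagonal A) *v graph_state (concatenated_graph G_out G_in A))"
proof -
  let ?G = "concatenated_graph G_out G_in A"
  obtain c1 where c1: "c1 \<noteq> 0"
    "\<And>\<phi> z. (tensor_power (inner_encoder G_in A) *v \<phi> :: ('p, 'm \<times> 'n) state) $ z =
      c1 * omega_pow (\<Sum>m\<in>UNIV. edge_form G_in (block z m)) * \<phi> $ (block_diagonal A *v z)"
    by (rule tensor_power_inner_encoder_mult[OF assms(1)]) blast
  obtain c2 where c2: "c2 \<noteq> 0" "graph_state G_out = c2 *s graph_vector G_out"
    by (rule graph_state_scaled[OF assms(2)])
  obtain c3 where c3: "c3 \<noteq> 0" "graph_state ?G = c3 *s graph_vector ?G"
    by (rule graph_state_scaled[OF labeled_graph_concatenated_graph[OF assms]])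
  \<comment> \<open>\<open>c1\<close> comes from the encoder, \<open>c2\<close> and
    \<open>c3\<close> from the scalings of the outer and concatenated graph states. The factor is
    the same for all \<open>c\<close>.\<close>
  have "tensor_power (inner_encoder G_in A) *v (pauli_Z c *v graph_state G_out) =
      (c1 * c2 / c3) *s (pauli_Z (c v* block_diagonal A) *v graph_state ?G)" for c
    using c3(1)
    by (simp add: vec_eq_iff c1 c2 c3 pauli_Z_mult graph_vector_def dot_product_vector_matrix
        edge_form_concatenated_graph[OF assms] omega_pow_add)
  then show thesis
    using that[of "c1 * c2 / c3"] c1 c2 c3 by simp
qed

lemma span_scaled_image:
  fixes f :: "'b \<Rightarrow> 'a::field ^ 'v"
  assumes "d \<noteq> 0"
  shows "vec.span ((\<lambda>c. d *s f c) ` C) = vec.span (f ` C)"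
proof -
  have "f c = inverse d *s (d *s f c)" for c
    using assms by (simp add: vec.scale_scale)
  then have "f ` C \<subseteq> vec.span ((\<lambda>c. d *s f c) ` C)"
    by (metis (no_types, lifting) image_subsetI image_eqI vec.span_base vec.span_scale)
  moreover have "(\<lambda>c. d *s f c) ` C \<subseteq> vec.span (f ` C)"
    by (auto intro: vec.span_scale vec.span_base)
  ultimately show ?thesis
    by (simp add: vec.span_eq)
qed

theorem mainTheorem1:
  fixes G_in :: "'p::prime_card mod_ring ^ 'n::finite ^ 'n"
    and C_in :: "('p mod_ring ^ 'n) set"
    and A_in :: "'p mod_ring ^ 'n ^ 'k::finite"
    and G_out :: "'p mod_ring ^ ('m::finite \<times> 'k) ^ ('m \<times> 'k)"
    and C_out :: "('p mod_ring ^ 'k ^ 'm) set"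
  assumes "CARD('k) \<le> CARD('n)"
    and "labeled_graph G_in"
    and "vec.subspace C_in" and "vec.dim C_in = CARD('k)"
    and "generator_matrix A_in C_in"
    and "labeled_graph G_out"
    and "\<And>m a b. G_out $ (m, a) $ (m, b) = 0"
    and "C_out \<noteq> {}"
  shows "\<exists>G_c :: 'p mod_ring ^ ('m \<times> 'n) ^ ('m \<times> 'n).
           labeled_graph G_c \<and>
           (\<forall>is. distinct is \<and> set is = UNIV \<longrightarrow>
              graph_concatenation (encoding_graph G_out G_in A_in) is = Some G_c) \<and>
           concatenated_code G_in A_in (CWS_code G_out (join_blocks ` C_out)) =
             CWS_code G_c (classical_concatenation A_in C_out)"
proof -
  let ?G = "concatenated_graph G_out G_in A_in"
  let ?T = "tensor_power (inner_encoder G_in A_in) :: ('p, 'm \<times> 'k, 'm \<times> 'n) operator"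
  obtain d where "d \<noteq> 0" and d: "\<And>c. ?T *v (pauli_Z c *v graph_state G_out) =
      d *s (pauli_Z (c v* block_diagonal A_in) *v graph_state ?G)"
    by (rule tensor_power_inner_encoder_graph_state[OF assms(2,6,7)]) blast
  have "concatenated_code G_in A_in (CWS_code G_out (join_blocks ` C_out)) =
      (*v) ?T ` vec.span ((\<lambda>c. pauli_Z c *v graph_state G_out) ` join_blocks ` C_out)"
    by (simp add: concatenated_code_def CWS_code_def Setcompr_eq_image)
  \<comment> \<open>A linear map sends a span onto the span of the images, so only the generating
    states need to be followed.\<close>
  also have "\<dots> = vec.span ((*v) ?T ` (\<lambda>c. pauli_Z c *v graph_state G_out) ` join_blocks ` C_out)"
    by (rule vec.linear_span_image[OF matrix_vector_mul_linear_gen, symmetric])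
  also have "\<dots> = vec.span ((\<lambda>c. d *s (pauli_Z (c v* block_diagonal A_in) *v graph_state ?G)) ` join_blocks ` C_out)"
    by (simp add: image_image d)
  also have "\<dots> = vec.span ((\<lambda>c. pauli_Z (c v* block_diagonal A_in) *v graph_state ?G) ` join_blocks ` C_out)"
    by (rule span_scaled_image[OF \<open>d \<noteq> 0\<close>])
  also have "\<dots> = CWS_code ?G (classical_concatenation A_in C_out)"
    by (simp add: CWS_code_def classical_concatenation_eq Setcompr_eq_image image_image)
  finally show ?thesis
    using labeled_graph_concatenated_graph[OF assms(2,6,7)]
      graph_concatenation_encoding_graph[OF assms(6,7)] by blast
qed

end
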